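(* For every integer $N \ge 1$, the map $\mathrm{pre}_3$ restricted to the set of partitions of size $N$ and length $6$ has fibers of cardinality at most $2$. That is, there do not exist three (pairwise) distinct partitions $\lambda_1, \lambda_2, \lambda_3$ of size $N$ and length $6$ such that $\mathrm{pre}_3(\lambda_1) = \mathrm{pre}_3(\lambda_2) = \mathrm{pre}_3(\lambda_3)$.
   Context: A partition of length $n$ is a weakly decreasing sequence $\lambda = (\lambda_1, \dots, \lambda_n)$ of positive integers; its size is $|\lambda| = \sum_{i=1}^n \lambda_i$. For $n \ge s$, the elementary symmetric partition map sends $\lambda$ to the multiset (equivalently, partition) of $\binom{n}{s}$ products $$\mathrm{pre}_s(\lambda) = \{\!\!\{ \lambda_{i_1}\lambda_{i_2}\cdots\lambda_{i_s} : 1 \le i_1 < i_2 < \dots < i_s \le n \}\!\!\}.$$ *)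

theory Defs
  imports "HOL-Library.Multiset"
begin

definition partitions :: "nat \<Rightarrow> nat \<Rightarrow> nat list set" where
  "partitions N n =
     {xs. length xs = n \<and> sorted_wrt (\<ge>) xs \<and> (\<forall>x \<in> set xs. x > 0) \<and> sum_list xs = N}"

text \<open>List positions start at 0, so the indices run over \<open>{..<length xs}\<close>. A choice of indices
  \<open>i\<^sub>1 < \<dots> < i\<^sub>s\<close> is represented by the set \<open>I = {i\<^sub>1, \<dots>, i\<^sub>s}\<close>; products arising from different
  index sets are counted with multiplicity.\<close>

definition pre :: "nat \<Rightarrow> nat list \<Rightarrow> nat multiset" where
  "pre s xs =
     {# (\<Prod>i\<in>I. xs ! i). I \<in># mset_set {I. I \<subseteq> {..<length xs} \<and> card I = s} #}"

lemma size_pre: "size (pre s xs) = length xs choose s"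
  by (simp add: pre_def n_subsets)

text \<open>Finiteness guarantees that \<open>card\<close> is the true cardinality of every fiber.\<close>

lemma finite_partitions: "finite (partitions N n)"
proof (rule finite_subset)
  show "partitions N n \<subseteq> {xs. set xs \<subseteq> {..N} \<and> length xs = n}"
    by (auto simp: partitions_def intro: member_le_sum_list)
  show "finite {xs. set xs \<subseteq> {..N} \<and> length xs = n}"
    by (rule finite_lists_length_eq) simp
qed

end

theory Submission
  imports Defs Complex_Main
begin

text \<open>
Write \<open>\<lambda>\<^sub>i = exp (x i)\<close> for \<open>i = 0, \<dots>, 5\<close>, with \<open>x\<close> decreasing. The map \<open>pre 3\<close> then records the multiset
of the twenty sums of three entries of \<open>x\<close>, and the size of the partition is the sum of \<open>exp (x i)\<close>.
Two of these sums always come first, \<open>x 0 + x 1 + x 2\<close> and \<open>x 0 + x 1 + x 3\<close>. The third place goes to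
\<open>x 0 + x 2 + x 3\<close> or to \<open>x 0 + x 1 + x 4\<close>, depending on whether \<open>x 1 + x 4 \<le> x 2 + x 3\<close>; this is the
type of \<open>x\<close>. Of three partitions two have the same type, so it is enough that two partitions of the
same type, the same size and the same image under \<open>pre 3\<close> are equal (\<open>partition_eq_if_same_type\<close>).
Replacing \<open>x\<close> by its negative read backwards exchanges the two types and turns equality of
the sums of \<open>exp (x i)\<close> into equality of the sums of \<open>- exp (- x i)\<close>, so only the first type
remains, for these two functions.

Let \<open>x\<close> and \<open>y\<close> be of the first type with the same triple sums. The three largest sums sit at the
same places for both, and the sums of the entries and of their squares agree as well. Hence
\<open>y - x = (2 h, - h, - h, - h, k, h - k)\<close> for some \<open>h\<close> and \<open>k\<close>. If \<open>h = 0\<close> then the squares force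
\<open>x = y\<close>; otherwise \<open>h > 0\<close> after exchanging \<open>x\<close> and \<open>y\<close> if necessary. The fourth and the fifth largest
sum, together with the sum of squares, show that \<open>k \<le> h\<close> (\<open>same_type_moves\<close>). So from \<open>x\<close> to \<open>y\<close>
the first entry goes up, the next three go down and the last does not go down. With equal first and
second moments, such a motion strictly increases the sum of every function whose second derivative
is strictly increasing (\<open>three_convex_sum_less\<close>). Both \<open>exp t\<close> and \<open>- exp (- t)\<close> are such functions, so the sizes
of the two partitions cannot agree.
\<close>

section \<open>Three-convex functions\<close>

text \<open>The parabola \<open>p t + q t\<^sup>2\<close> is an antiderivative of the secant of \<open>\<phi>\<close> through \<open>a\<close> and \<open>b\<close>. Since \<open>\<phi>\<close> is
strictly convex, it lies above this secant outside \<open>{a..b}\<close> and below it inside, and this sign is the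
sign of the derivative of \<open>f\<close> minus the parabola.\<close>

lemma secant_parabola:
  fixes f \<phi> \<psi> :: "real \<Rightarrow> real" and a b :: real
  assumes f: "\<And>t. (f has_real_derivative \<phi> t) (at t)"
    and \<phi>: "\<And>t. (\<phi> has_real_derivative \<psi> t) (at t)"
    and \<psi>: "strict_mono \<psi>" and ab: "a < b"
  obtains p q where
    "\<And>s t. b \<le> s \<Longrightarrow> s < t \<Longrightarrow> f s - (p * s + q * s\<^sup>2) < f t - (p * t + q * t\<^sup>2)"
    "\<And>s t. s < t \<Longrightarrow> t \<le> a \<Longrightarrow> f s - (p * s + q * s\<^sup>2) < f t - (p * t + q * t\<^sup>2)"
    "\<And>s t. a \<le> s \<Longrightarrow> s < t \<Longrightarrow> t \<le> b \<Longrightarrow> f t - (p * t + q * t\<^sup>2) < f s - (p * s + q * s\<^sup>2)"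
proof -
  obtain z where z: "a < z" "z < b" "\<phi> b - \<phi> a = (b - a) * \<psi> z"
    using MVT2[OF ab, of \<phi> \<psi>] \<phi> by blast
  define u where "u t = \<phi> t - (\<phi> a + \<psi> z * (t - a))" for t
  have u_ab: "u a = 0" "u b = 0"
    using z(3) by (simp_all add: u_def algebra_simps)
  have du: "(u has_real_derivative \<psi> t - \<psi> z) (at t)" for t
    unfolding u_def by (rule derivative_eq_intros \<phi> refl | simp)+
  have u_mvt: "\<exists>w. s < w \<and> w < t \<and> u t - u s = (t - s) * (\<psi> w - \<psi> z)" if "s < t" for s t
    using MVT2[OF that, of u "\<lambda>t. \<psi> t - \<psi> z"] du by blast
  have u_inc: "u s < u t" if st: "z \<le> s" "s < t" for s t
  proof -
    obtain w where w: "s < w" "u t - u s = (t - s) * (\<psi> w - \<psi> z)" using u_mvt[OF st(2)] by blast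
    have "\<psi> z < \<psi> w" using \<psi> st w(1) by (simp add: strict_mono_less)
    then have "0 < (t - s) * (\<psi> w - \<psi> z)" using st(2) by simp
    then show ?thesis using w(2) by linarith
  qed
  have u_dec: "u t < u s" if st: "s < t" "t \<le> z" for s t
  proof -
    obtain w where w: "w < t" "u t - u s = (t - s) * (\<psi> w - \<psi> z)" using u_mvt[OF st(1)] by blast
    have "\<psi> w < \<psi> z" using \<psi> st w(1) by (simp add: strict_mono_less)
    then have "(t - s) * (\<psi> w - \<psi> z) < 0" using st(1) by (simp add: mult_pos_neg)
    then show ?thesis using w(2) by linarith
  qed
  have u_right: "0 < u t" if "b < t" for t using u_inc[of b t] z u_ab that by simp
  have u_left: "0 < u t" if "t < a" for t using u_dec[of t a] z u_ab that by simp
  have u_mid: "u t < 0" if "a < t" "t < b" for t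
    using u_dec[of a t] u_inc[of t b] u_ab that by (cases "t \<le> z") auto
  define p where "p = \<phi> a - \<psi> z * a"
  define q where "q = \<psi> z / 2"
  define g where "g t = f t - (p * t + q * t\<^sup>2)" for t
  have dg: "(g has_real_derivative u t) (at t)" for t
    unfolding g_def u_def p_def q_def
    by (rule derivative_eq_intros f refl | simp add: algebra_simps)+
  have g_mvt: "\<exists>w. s < w \<and> w < t \<and> g t - g s = (t - s) * u w" if "s < t" for s t
    using MVT2[OF that, of g u] dg by blast
  have "g s < g t" if st: "b \<le> s" "s < t" for s t
  proof -
    obtain w where w: "s < w" "g t - g s = (t - s) * u w" using g_mvt[OF st(2)] by blast
    with st have "0 < (t - s) * u w" by (intro mult_pos_pos u_right) auto
    with w show ?thesis by linarith
  qed
  moreover have "g s < g t" if st: "s < t" "t \<le> a" for s t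
  proof -
    obtain w where w: "w < t" "g t - g s = (t - s) * u w" using g_mvt[OF st(1)] by blast
    with st have "0 < (t - s) * u w" by (intro mult_pos_pos u_left) auto
    with w show ?thesis by linarith
  qed
  moreover have "g t < g s" if st: "a \<le> s" "s < t" "t \<le> b" for s t
  proof -
    obtain w where w: "s < w" "w < t" "g t - g s = (t - s) * u w" using g_mvt[OF st(2)] by blast
    with st have "(t - s) * u w < 0" by (intro mult_pos_neg u_mid) auto
    with w show ?thesis by linarith
  qed
  ultimately show ?thesis using that unfolding g_def by blast
qed

lemma sum_lessThan_6: "(\<Sum>i<6. z i) = z 0 + z 1 + z 2 + z 3 + z 4 + z (5::nat)"
  for z :: "nat \<Rightarrow> real"
  by (simp add: eval_nat_numeral)

lemma antimono_on_lessThan_6D: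
  fixes z :: "nat \<Rightarrow> real"
  assumes "antimono_on {..<6} z"
  shows "z 1 \<le> z 0" "z 2 \<le> z 1" "z 3 \<le> z 2" "z 4 \<le> z 3" "z 5 \<le> z 4"
  by (auto intro!: monotone_onD[OF assms])

text \<open>Subtracting a parabola from \<open>f\<close> does not affect the difference of the two sums, because the first
two moments agree. With the parabola of \<open>secant_parabola\<close> for a suitable interval, no move
from \<open>x i\<close> to \<open>y i\<close> decreases the remaining function: the upward moves take place outside the
interval, where it increases, and the downward moves inside, where it decreases.\<close>

lemma three_convex_sum_less:
  fixes f \<phi> \<psi> :: "real \<Rightarrow> real" and x y :: "nat \<Rightarrow> real"
  assumes f: "\<And>t. (f has_real_derivative \<phi> t) (at t)"
    and \<phi>: "\<And>t. (\<phi> has_real_derivative \<psi> t) (at t)"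
    and \<psi>: "strict_mono \<psi>"
    and x: "antimono_on {..<6} x" and y: "antimono_on {..<6} y"
    and moves: "x 0 < y 0" "y 1 < x 1" "y 2 < x 2" "y 3 < x 3" "x 5 \<le> y 5"
    and m1: "(\<Sum>i<6. x i) = (\<Sum>i<6. y i)"
    and m2: "(\<Sum>i<6. (x i)\<^sup>2) = (\<Sum>i<6. (y i)\<^sup>2)"
  shows "(\<Sum>i<6. f (x i)) < (\<Sum>i<6. f (y i))"
proof -
  note xs = antimono_on_lessThan_6D[OF x] and ys = antimono_on_lessThan_6D[OF y]
  \<comment> \<open>The interval is \<open>{a..x 1}\<close>. It has to contain the move of entry 4 when that goes down, and to lie
    above it when it goes up.\<close>
  define a where "a = (if x 4 \<le> y 4 then y 3 else y 4)"
  have a: "a < x 1" "a \<le> y 3" "y 5 \<le> a" using xs ys moves by (auto simp: a_def)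
  obtain p q where right: "\<And>s t. x 1 \<le> s \<Longrightarrow> s < t \<Longrightarrow> f s - (p * s + q * s\<^sup>2) < f t - (p * t + q * t\<^sup>2)"
    and left: "\<And>s t. s < t \<Longrightarrow> t \<le> a \<Longrightarrow> f s - (p * s + q * s\<^sup>2) < f t - (p * t + q * t\<^sup>2)"
    and mid: "\<And>s t. a \<le> s \<Longrightarrow> s < t \<Longrightarrow> t \<le> x 1 \<Longrightarrow> f t - (p * t + q * t\<^sup>2) < f s - (p * s + q * s\<^sup>2)"
    using secant_parabola[OF f \<phi> \<psi> a(1)] by blast
  define g where "g t = f t - (p * t + q * t\<^sup>2)" for t
  note right = right[folded g_def] and left = left[folded g_def] and mid = mid[folded g_def]
  have "g (x 0) < g (y 0)" using right[of "x 0" "y 0"] xs moves by simp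
  moreover have "g (x 1) < g (y 1)" "g (x 2) < g (y 2)" "g (x 3) < g (y 3)"
    using xs ys moves a by (auto intro!: mid)
  moreover have "g (x 4) \<le> g (y 4)"
  proof (cases "x 4 \<le> y 4")
    case True
    then show ?thesis using left[of "x 4" "y 4"] ys by (cases "x 4 = y 4") (auto simp: a_def)
  next
    case False
    then show ?thesis using mid[of "y 4" "x 4"] xs by (auto simp: a_def)
  qed
  moreover have "g (x 5) \<le> g (y 5)"
    using left[of "x 5" "y 5"] a(3) moves by (cases "x 5 = y 5") auto
  ultimately have "(\<Sum>i<6. g (x i)) < (\<Sum>i<6. g (y i))"
    by (simp add: sum_lessThan_6)
  moreover have "(\<Sum>i<6. g (z i)) = (\<Sum>i<6. f (z i)) - (p * (\<Sum>i<6. z i) + q * (\<Sum>i<6. (z i)\<^sup>2))"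
    for z :: "nat \<Rightarrow> real"
    by (simp add: g_def sum_subtractf sum.distrib sum_distrib_left)
  ultimately show ?thesis using m1 m2 by simp
qed

section \<open>Triple sums\<close>

definition triple_sums :: "(nat \<Rightarrow> real) \<Rightarrow> real multiset" where
  "triple_sums x = {# (\<Sum>i\<in>I. x i). I \<in># mset_set {I. I \<subseteq> {..<6} \<and> card I = 3} #}"

lemma mset_set_subsets_card:
  assumes "distinct xs"
  shows "mset_set {I. I \<subseteq> set xs \<and> card I = s} = mset (map set (filter (\<lambda>l. length l = s) (subseqs xs)))"
proof -
  let ?L = "filter (\<lambda>l. length l = s) (subseqs xs)"
  have card: "card (set l) = length l" if "l \<in> set (subseqs xs)" for l
    using that assms by (simp add: distinct_card subseqs_distinctD)
  have "distinct (map set ?L)"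
    using distinct_set_subseqs[OF assms] by (auto simp: distinct_map intro: inj_on_subset)
  moreover have "set (map set ?L) = {I. I \<subseteq> set xs \<and> card I = s}"
  proof -
    have "{I. I \<subseteq> set xs \<and> card I = s} = {I \<in> set ` set (subseqs xs). card I = s}"
      by (auto simp: subseqs_powset)
    also have "\<dots> = set (map set ?L)" using card by auto
    finally show ?thesis ..
  qed
  ultimately show ?thesis by (metis mset_set_set)
qed

text \<open>The triples are listed with the largest index varying slowest. For a decreasing \<open>x\<close> of
the first type, the three sums in front are then the three largest, and the fourth largest is one of
the next two.\<close>

lemma triple_sums_eq:
  "triple_sums x =
     {# x 0 + x 1 + x 2, x 0 + x 1 + x 3, x 0 + x 2 + x 3, x 1 + x 2 + x 3, x 0 + x 1 + x 4,
        x 0 + x 2 + x 4, x 1 + x 2 + x 4, x 0 + x 3 + x 4, x 1 + x 3 + x 4, x 2 + x 3 + x 4,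
        x 0 + x 1 + x 5, x 0 + x 2 + x 5, x 1 + x 2 + x 5, x 0 + x 3 + x 5, x 1 + x 3 + x 5,
        x 2 + x 3 + x 5, x 0 + x 4 + x 5, x 1 + x 4 + x 5, x 2 + x 4 + x 5, x 3 + x 4 + x 5 #}"
proof -
  have lt6: "{..<6::nat} = set [5,4,3,2,1,0]" by auto
  have eq: "mset_set {I. I \<subseteq> {..<6::nat} \<and> card I = 3} =
      mset (rev (map set (filter (\<lambda>l. length l = 3) (subseqs [5,4,3,2,1,0]))))"
    unfolding mset_rev lt6 by (rule mset_set_subsets_card) simp
  show ?thesis
    unfolding triple_sums_def eq by (simp add: ac_simps)
qed

lemma triple_sums_rev_uminus: "triple_sums (\<lambda>i. - x (5 - i)) = image_mset uminus (triple_sums x)"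
proof -
  let ?K = "{I. I \<subseteq> {..<6::nat} \<and> card I = 3}" and ?r = "\<lambda>i::nat. 5 - i"
  have inj: "inj_on ?r I" if "I \<subseteq> {..<6}" for I
  proof (rule inj_on_inverseI[where g = ?r])
    fix i assume "i \<in> I"
    then have "i \<le> 5" using that by auto
    then show "5 - (5 - i) = i" by (rule diff_diff_cancel)
  qed
  have rr: "?r ` ?r ` I = I" if "I \<subseteq> {..<6}" for I
    using that by (force simp: image_iff)
  have "bij_betw ((`) ?r) ?K ?K"
    by (rule bij_betw_byWitness[where f' = "(`) ?r"]) (auto simp: rr card_image inj)
  then have "mset_set ?K = image_mset ((`) ?r) (mset_set ?K)"
    by (simp add: bij_betw_def image_mset_mset_set)
  then have "triple_sums (\<lambda>i. - x (5 - i)) =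
      image_mset (\<lambda>I. \<Sum>i\<in>I. - x (5 - i)) (image_mset ((`) ?r) (mset_set ?K))"
    unfolding triple_sums_def by (rule arg_cong)
  also have "\<dots> = {# (\<Sum>i\<in>?r ` I. - x (5 - i)). I \<in># mset_set ?K #}"
    by (simp add: image_mset.compositionality comp_def)
  also have "\<dots> = {# - (\<Sum>i\<in>I. x i). I \<in># mset_set ?K #}"
  proof (rule image_mset_cong)
    fix I assume "I \<in># mset_set ?K"
    then have I: "I \<subseteq> {..<6}" by (auto simp: finite_subset)
    then have "(\<Sum>i\<in>?r ` I. - x (5 - i)) = (\<Sum>i\<in>I. - x (5 - (5 - i)))"
      by (simp add: sum.reindex inj)
    also have "\<dots> = - (\<Sum>i\<in>I. x i)"
      unfolding sum_negf using I by (intro arg_cong[where f = uminus] sum.cong) auto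
    finally show "(\<Sum>i\<in>?r ` I. - x (5 - i)) = - (\<Sum>i\<in>I. x i)" .
  qed
  finally show ?thesis by (simp add: triple_sums_def image_mset.compositionality comp_def)
qed

text \<open>This peels equal multisets from the top, one largest element at a time.\<close>

lemma add_mset_max_eq:
  fixes a b :: "'a :: order"
  assumes "add_mset a M = add_mset b M'" "\<And>c. c \<in># M \<Longrightarrow> c \<le> a" "\<And>c. c \<in># M' \<Longrightarrow> c \<le> b"
  shows "a = b" and "M = M'"
proof -
  show "a = b" using assms by (metis add_eq_conv_ex antisym union_single_eq_member)
  then show "M = M'" using assms(1) by simp
qed

text \<open>Each entry lies in ten triples and each pair of entries in four, so the first two power sums of the
triple sums determine those of \<open>x\<close>: the second is \<open>10\<close> times the squares plus \<open>8\<close> times the products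
of pairs.\<close>

lemma triple_sums_moments:
  assumes "triple_sums x = triple_sums y"
  shows "(\<Sum>i<6. x i) = (\<Sum>i<6. y i)" and "(\<Sum>i<6. (x i)\<^sup>2) = (\<Sum>i<6. (y i)\<^sup>2)"
proof -
  have s1: "sum_mset (triple_sums z) = 10 * (\<Sum>i<6. z i)" for z
    by (simp add: triple_sums_eq sum_lessThan_6)
  have s2: "(\<Sum>s\<in>#triple_sums z. s\<^sup>2) = 6 * (\<Sum>i<6. (z i)\<^sup>2) + 4 * (\<Sum>i<6. z i)\<^sup>2" for z
    by (simp add: triple_sums_eq sum_lessThan_6 power2_eq_square algebra_simps)
  show m1: "(\<Sum>i<6. x i) = (\<Sum>i<6. y i)" using s1[of x] s1[of y] assms by simp
  show "(\<Sum>i<6. (x i)\<^sup>2) = (\<Sum>i<6. (y i)\<^sup>2)" using s2[of x] s2[of y] m1 assms by simp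
qed

section \<open>Sequences of the first type\<close>

lemma eq_if_agree_on_four:
  fixes x y :: "nat \<Rightarrow> real"
  assumes x: "antimono_on {..<6} x" and y: "antimono_on {..<6} y"
    and agree: "x 0 = y 0" "x 1 = y 1" "x 2 = y 2" "x 3 = y 3"
    and m1: "(\<Sum>i<6. x i) = (\<Sum>i<6. y i)"
    and m2: "(\<Sum>i<6. (x i)\<^sup>2) = (\<Sum>i<6. (y i)\<^sup>2)"
    and i: "i < 6"
  shows "x i = y i"
proof -
  note le = antimono_on_lessThan_6D(5)[OF x] antimono_on_lessThan_6D(5)[OF y]
  have s: "x 4 + x 5 = y 4 + y 5" and q: "(x 4)\<^sup>2 + (x 5)\<^sup>2 = (y 4)\<^sup>2 + (y 5)\<^sup>2"
    using m1 m2 agree by (simp_all add: sum_lessThan_6)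
  have "(x 4 - x 5)\<^sup>2 = 2 * ((x 4)\<^sup>2 + (x 5)\<^sup>2) - (x 4 + x 5)\<^sup>2" by algebra
  also have "\<dots> = (y 4 - y 5)\<^sup>2" unfolding s q by algebra
  finally have "x 4 - x 5 = y 4 - y 5" using le by (simp add: power2_eq_iff_nonneg)
  then have "x 4 = y 4" "x 5 = y 5" using s by linarith+
  moreover have "i = 0 \<or> i = 1 \<or> i = 2 \<or> i = 3 \<or> i = 4 \<or> i = 5" using i by linarith
  ultimately show ?thesis using agree by auto
qed

text \<open>The type hypothesis puts \<open>x 0 + x 2 + x 3\<close> in third place for both sequences, so the three
largest sums can be matched position by position. Which of \<open>x 1 + x 2 + x 3\<close> and \<open>x 0 + x 1 + x 4\<close> comes
fourth is left open; the second one bounds everything that follows.\<close>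

lemma same_type_top_sums:
  assumes x: "antimono_on {..<6} x" and y: "antimono_on {..<6} y"
    and sums: "triple_sums x = triple_sums y"
    and tx: "x 1 + x 4 \<le> x 2 + x 3" and ty: "y 1 + y 4 \<le> y 2 + y 3"
  obtains M M' where
    "x 0 + x 1 + x 2 = y 0 + y 1 + y 2"
    "x 0 + x 1 + x 3 = y 0 + y 1 + y 3"
    "x 0 + x 2 + x 3 = y 0 + y 2 + y 3"
    "add_mset (x 1 + x 2 + x 3) (add_mset (x 0 + x 1 + x 4) M) =
     add_mset (y 1 + y 2 + y 3) (add_mset (y 0 + y 1 + y 4) M')"
    "\<And>c. c \<in># M \<Longrightarrow> c \<le> x 0 + x 1 + x 4"
    "\<And>c. c \<in># M' \<Longrightarrow> c \<le> y 0 + y 1 + y 4"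
proof -
  note xs = antimono_on_lessThan_6D[OF x] and ys = antimono_on_lessThan_6D[OF y]
  define M where "M z =
     {# z 0 + z 2 + z 4, z 1 + z 2 + z 4, z 0 + z 3 + z 4, z 1 + z 3 + z 4, z 2 + z 3 + z 4,
        z 0 + z 1 + z 5, z 0 + z 2 + z 5, z 1 + z 2 + z 5, z 0 + z 3 + z 5, z 1 + z 3 + z 5,
        z 2 + z 3 + z 5, z 0 + z 4 + z 5, z 1 + z 4 + z 5, z 2 + z 4 + z 5, z 3 + z 4 + z 5 #}"
    for z :: "nat \<Rightarrow> real"
  define M2 where "M2 z = add_mset (z 1 + z 2 + z 3) (add_mset (z 0 + z 1 + z 4) (M z))" for z
  define M1 where "M1 z = add_mset (z 0 + z 2 + z 3) (M2 z)" for z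
  define M0 where "M0 z = add_mset (z 0 + z 1 + z 3) (M1 z)" for z
  have T: "triple_sums z = add_mset (z 0 + z 1 + z 2) (M0 z)" for z
    by (simp only: triple_sums_eq M_def M0_def M1_def M2_def)
  have M: "c \<le> x 0 + x 1 + x 4" if "c \<in># M x" for c
    using that xs by (auto simp: M_def)
  have M': "c \<le> y 0 + y 1 + y 4" if "c \<in># M y" for c
    using that ys by (auto simp: M_def)
  have M2: "c \<le> x 0 + x 2 + x 3" if "c \<in># M2 x" for c
    using that xs tx M[of c] by (auto simp: M2_def)
  have M2': "c \<le> y 0 + y 2 + y 3" if "c \<in># M2 y" for c
    using that ys ty M'[of c] by (auto simp: M2_def)
  have M1: "c \<le> x 0 + x 1 + x 3" if "c \<in># M1 x" for c
    using that xs M2[of c] by (auto simp: M1_def)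
  have M1': "c \<le> y 0 + y 1 + y 3" if "c \<in># M1 y" for c
    using that ys M2'[of c] by (auto simp: M1_def)
  have M0: "c \<le> x 0 + x 1 + x 2" if "c \<in># M0 x" for c
    using that xs M1[of c] by (auto simp: M0_def)
  have M0': "c \<le> y 0 + y 1 + y 2" if "c \<in># M0 y" for c
    using that ys M1'[of c] by (auto simp: M0_def)
  note 0 = add_mset_max_eq[OF sums[unfolded T] M0 M0']
  note 1 = add_mset_max_eq[OF 0(2)[unfolded M0_def] M1 M1']
  note 2 = add_mset_max_eq[OF 1(2)[unfolded M1_def] M2 M2']
  show ?thesis
    using that[OF 0(1) 1(1) 2(1) 2(2)[unfolded M2_def] M M'] .
qed

text \<open>The matched sums give \<open>y - x = (2 h, - h, - h, - h, k, h - k)\<close> with \<open>h > 0\<close>, and the claim about the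
last entry is \<open>k \<le> h\<close>. Suppose \<open>k > h\<close>. The fourth largest sum is then \<open>x 1 + x 2 + x 3\<close> for \<open>x\<close> and
\<open>y 0 + y 1 + y 4\<close> for \<open>y\<close>, and the next one bounds \<open>k\<close> above by \<open>2 h\<close>. Equality of the sums of squares
bounds \<open>k\<close> below by \<open>5 h\<close>.\<close>

lemma same_type_moves:
  assumes x: "antimono_on {..<6} x" and y: "antimono_on {..<6} y"
    and sums: "triple_sums x = triple_sums y"
    and tx: "x 1 + x 4 \<le> x 2 + x 3" and ty: "y 1 + y 4 \<le> y 2 + y 3"
    and less: "y 1 < x 1"
  shows "x 0 < y 0" "y 2 < x 2" "y 3 < x 3" "x 5 \<le> y 5"
proof -
  note xs = antimono_on_lessThan_6D[OF x] and ys = antimono_on_lessThan_6D[OF y]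
  obtain M M' where top: "x 0 + x 1 + x 2 = y 0 + y 1 + y 2"
      "x 0 + x 1 + x 3 = y 0 + y 1 + y 3" "x 0 + x 2 + x 3 = y 0 + y 2 + y 3"
    and rest: "add_mset (x 1 + x 2 + x 3) (add_mset (x 0 + x 1 + x 4) M) =
         add_mset (y 1 + y 2 + y 3) (add_mset (y 0 + y 1 + y 4) M')"
    and M: "\<And>c. c \<in># M \<Longrightarrow> c \<le> x 0 + x 1 + x 4"
    and M': "\<And>c. c \<in># M' \<Longrightarrow> c \<le> y 0 + y 1 + y 4"
    using same_type_top_sums[OF x y sums tx ty] by blast
  define h where "h = x 1 - y 1"
  define k where "k = y 4 - x 4"
  have h: "0 < h" using less by (simp add: h_def)
  have yx: "y 0 = x 0 + 2 * h" "y 1 = x 1 - h" "y 2 = x 2 - h" "y 3 = x 3 - h"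
    using top by (auto simp: h_def)
  have m1: "(\<Sum>i<6. x i) = (\<Sum>i<6. y i)" and m2: "(\<Sum>i<6. (x i)\<^sup>2) = (\<Sum>i<6. (y i)\<^sup>2)"
    using triple_sums_moments[OF sums] .
  have yx45: "y 4 = x 4 + k" "y 5 = x 5 + (h - k)"
    using m1 yx by (auto simp: sum_lessThan_6 k_def)
  show "x 0 < y 0" "y 2 < x 2" "y 3 < x 3" using yx h by simp_all
  show "x 5 \<le> y 5"
  proof (rule ccontr)
    assume "\<not> x 5 \<le> y 5"
    then have k: "h < k" using yx45 by simp
    \<comment> \<open>Both \<open>y 0 + y 1 + y 4\<close> and \<open>x 1 + x 2 + x 3\<close> exceed their counterparts in the other sequence, so
      each can be bounded only by the other.\<close>
    have "y 0 + y 1 + y 4 \<in># add_mset (x 1 + x 2 + x 3) (add_mset (x 0 + x 1 + x 4) M)"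
      unfolding rest by simp
    then have "y 0 + y 1 + y 4 \<le> x 1 + x 2 + x 3"
      using yx yx45 k h by (auto dest: M)
    moreover have "x 1 + x 2 + x 3 \<in># add_mset (y 1 + y 2 + y 3) (add_mset (y 0 + y 1 + y 4) M')"
      unfolding rest[symmetric] by simp
    then have "x 1 + x 2 + x 3 \<le> y 0 + y 1 + y 4"
      using yx h by (auto dest: M')
    ultimately have fourth: "x 1 + x 2 + x 3 = y 0 + y 1 + y 4" by simp
    then have "add_mset (x 0 + x 1 + x 4) M = add_mset (y 1 + y 2 + y 3) M'"
      using rest by (simp add: add_mset_commute)
    then have "y 1 + y 2 + y 3 \<in># add_mset (x 0 + x 1 + x 4) M" by simp
    then have fifth: "y 1 + y 2 + y 3 \<le> x 0 + x 1 + x 4" by (auto dest: M)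
    \<comment> \<open>The sums of squares are compared through \<open>(y i)\<^sup>2 - (x i)\<^sup>2 = (y i - x i) * (x i + y i)\<close>.\<close>
    define s where "s i = x i + y i" for i
    have diff: "y 0 - x 0 = 2 * h" "y 1 - x 1 = - h" "y 2 - x 2 = - h" "y 3 - x 3 = - h"
        "y 4 - x 4 = k" "y 5 - x 5 = h - k"
      using yx yx45 by simp_all
    have "(y i - x i) * s i = (y i)\<^sup>2 - (x i)\<^sup>2" for i
      by (simp add: s_def power2_eq_square algebra_simps)
    then have "(\<Sum>i<6. (y i - x i) * s i) = 0"
      using m2 by (simp add: sum_subtractf)
    then have "2 * h * s 0 - h * s 1 - h * s 2 - h * s 3 + k * s 4 + (h - k) * s 5 = 0"
      unfolding sum_lessThan_6 diff by simp
    then have "h * (2 * s 0 - s 1 - s 2 - s 3 + s 4) = - ((k - h) * (s 4 - s 5))"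
      by (simp add: algebra_simps)
    also have "\<dots> \<le> 0" using k xs ys by (simp add: s_def)
    finally have "2 * s 0 - s 1 - s 2 - s 3 + s 4 \<le> 0" using h by (simp add: mult_le_0_iff)
    then have "2 * (x 0 - x 1) + 5 * h \<le> k"
      using fourth unfolding s_def yx yx45 by argo
    moreover have "k \<le> 2 * h" using fourth fifth unfolding yx yx45 by linarith
    ultimately show False using xs(1) h by argo
  qed
qed

lemma same_type_unique:
  fixes f \<phi> \<psi> :: "real \<Rightarrow> real"
  assumes x: "antimono_on {..<6} x" and y: "antimono_on {..<6} y"
    and sums: "triple_sums x = triple_sums y"
    and tx: "x 1 + x 4 \<le> x 2 + x 3" and ty: "y 1 + y 4 \<le> y 2 + y 3"
    and f: "\<And>t. (f has_real_derivative \<phi> t) (at t)"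
    and \<phi>: "\<And>t. (\<phi> has_real_derivative \<psi> t) (at t)"
    and \<psi>: "strict_mono \<psi>"
    and eq: "(\<Sum>i<6. f (x i)) = (\<Sum>i<6. f (y i))"
    and i: "i < 6"
  shows "x i = y i"
proof -
  note m = triple_sums_moments[OF sums]
  consider "y 1 < x 1" | "x 1 < y 1" | "x 1 = y 1" by linarith
  then show ?thesis
  proof cases
    case 1
    note same_type_moves[OF x y sums tx ty 1]
    from three_convex_sum_less[OF f \<phi> \<psi> x y this(1) 1 this(2-4) m] eq show ?thesis by simp
  next
    case 2
    note same_type_moves[OF y x sums[symmetric] ty tx 2]
    from three_convex_sum_less[OF f \<phi> \<psi> y x this(1) 2 this(2-4) m[symmetric]] eq
    show ?thesis by simp
  next
    case 3
    obtain M M' where "x 0 + x 1 + x 2 = y 0 + y 1 + y 2"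
      "x 0 + x 1 + x 3 = y 0 + y 1 + y 3" "x 0 + x 2 + x 3 = y 0 + y 2 + y 3"
      using same_type_top_sums[OF x y sums tx ty] by metis
    with 3 have "x 0 = y 0" "x 2 = y 2" "x 3 = y 3" by linarith+
    with 3 show ?thesis using eq_if_agree_on_four[OF x y _ _ _ _ m i] by simp
  qed
qed

section \<open>Partitions\<close>

lemma triple_sums_ln:
  assumes "length xs = 6" and "\<forall>x \<in> set xs. x > 0"
  shows "triple_sums (\<lambda>i. ln (real (xs ! i))) = image_mset (\<lambda>n. ln (real n)) (pre 3 xs)"
proof -
  have "(\<Sum>i\<in>I. ln (real (xs ! i))) = ln (real (\<Prod>i\<in>I. xs ! i))" if "I \<subseteq> {..<6}" for I
  proof -
    have "finite I" using that finite_subset by blast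
    moreover have "0 < xs ! i" if "i \<in> I" for i
      using that \<open>I \<subseteq> {..<6}\<close> assms by (auto simp: subset_iff)
    ultimately show ?thesis by (simp add: ln_prod)
  qed
  then show ?thesis
    unfolding triple_sums_def pre_def assms(1) image_mset.compositionality comp_def
    by (intro image_mset_cong) auto
qed

text \<open>On logarithms the type condition reads as in \<open>same_type_unique\<close>. When it fails, it holds for the
logarithms of the reciprocals in reverse order, and the size becomes a sum of values of
\<open>- exp (- t)\<close>.\<close>

lemma partition_eq_if_same_type:
  assumes xs: "xs \<in> partitions N 6" and ys: "ys \<in> partitions N 6"
    and pre: "pre 3 xs = pre 3 ys"
    and type: "xs ! 1 * xs ! 4 \<le> xs ! 2 * xs ! 3 \<longleftrightarrow> ys ! 1 * ys ! 4 \<le> ys ! 2 * ys ! 3"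
  shows "xs = ys"
proof -
  define L where "L zs i = ln (real (zs ! i))" for zs :: "nat list" and i :: nat
  have len: "length zs = 6" and pos: "\<And>i. i < 6 \<Longrightarrow> 0 < zs ! i"
    and sorted: "\<And>i j. i \<le> j \<Longrightarrow> j < 6 \<Longrightarrow> zs ! j \<le> zs ! i" and total: "(\<Sum>i<6. zs ! i) = N"
    if "zs \<in> partitions N 6" for zs
  proof -
    show len: "length zs = 6" using that by (simp add: partitions_def)
    show "0 < zs ! i" if "i < 6" for i
      using \<open>zs \<in> _\<close> that by (simp add: partitions_def)
    show "zs ! j \<le> zs ! i" if "i \<le> j" "j < 6" for i j
      using \<open>zs \<in> _\<close> that by (cases "i = j") (auto simp: partitions_def sorted_wrt_iff_nth_less)
    show "(\<Sum>i<6. zs ! i) = N"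
      using that len by (simp add: partitions_def sum_list_sum_nth atLeast0LessThan)
  qed
  have mono: "antimono_on {..<6} (L zs)" if "zs \<in> partitions N 6" for zs
    using pos[OF that] sorted[OF that] by (auto simp: monotone_on_def L_def)
  have sums: "triple_sums (L xs) = triple_sums (L ys)"
    using xs ys pre unfolding L_def by (simp add: triple_sums_ln partitions_def)
  have expL: "(\<Sum>i<6. exp (L zs i)) = real N" if "zs \<in> partitions N 6" for zs
  proof -
    have "(\<Sum>i<6. exp (L zs i)) = (\<Sum>i<6. real (zs ! i))"
      using pos[OF that] by (intro sum.cong) (auto simp: L_def)
    then show ?thesis using total[OF that] by (simp flip: of_nat_sum)
  qed
  have le_iff: "L zs 1 + L zs 4 \<le> L zs 2 + L zs 3 \<longleftrightarrow> zs ! 1 * zs ! 4 \<le> zs ! 2 * zs ! 3"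
    if "zs \<in> partitions N 6" for zs
    using pos[OF that, of 1] pos[OF that, of 2] pos[OF that, of 3] pos[OF that, of 4]
    by (simp add: L_def flip: ln_mult_pos of_nat_mult)
  have L_eq: "L xs i = L ys i" if "i < 6" for i
  proof (cases "xs ! 1 * xs ! 4 \<le> xs ! 2 * xs ! 3")
    case True
    show ?thesis
    proof (rule same_type_unique[OF mono[OF xs] mono[OF ys] sums, of exp exp exp])
      show "strict_mono (exp :: real \<Rightarrow> real)" by (simp add: strict_mono_def)
    qed (use True type le_iff[OF xs] le_iff[OF ys] expL xs ys that in \<open>auto intro: DERIV_exp\<close>)
  next
    case False
    define R where "R zs i = - L zs (5 - i)" for zs i
    have monoR: "antimono_on {..<6} (R zs)" if "zs \<in> partitions N 6" for zs
      using mono[OF that] by (auto simp: monotone_on_def R_def)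
    have sumsR: "triple_sums (R xs) = triple_sums (R ys)"
      unfolding R_def triple_sums_rev_uminus sums ..
    have expR: "(\<Sum>i<6. - exp (- R zs i)) = - real N" if "zs \<in> partitions N 6" for zs
      using expL[OF that] by (simp add: sum_lessThan_6 R_def)
    have "R xs (5 - i) = R ys (5 - i)"
    proof (rule same_type_unique[OF monoR[OF xs] monoR[OF ys] sumsR, of "\<lambda>t. - exp (- t)" "\<lambda>t. exp (- t)" "\<lambda>t. - exp (- t)"])
      show "strict_mono (\<lambda>t::real. - exp (- t))" by (simp add: strict_mono_def)
      show "((\<lambda>t. - exp (- t)) has_real_derivative exp (- t)) (at t)"
        and "((\<lambda>t. exp (- t)) has_real_derivative - exp (- t)) (at t)" for t :: real
        by (auto intro!: derivative_eq_intros)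
      show "R xs 1 + R xs 4 \<le> R xs 2 + R xs 3" "R ys 1 + R ys 4 \<le> R ys 2 + R ys 3"
        using False type le_iff[OF xs] le_iff[OF ys] by (auto simp: R_def)
    qed (use expR xs ys in auto)
    then show ?thesis using that by (simp add: R_def)
  qed
  have "xs ! i = ys ! i" if "i < 6" for i
    using that L_eq[OF that] pos[OF xs, of i] pos[OF ys, of i] by (simp add: L_def)
  then show ?thesis using len[OF xs] len[OF ys] by (simp add: nth_equalityI)
qed

theorem theorem1p6:
  fixes N :: nat
  assumes "N \<ge> 1"
  shows "(\<forall>M. card {xs \<in> partitions N 6. pre 3 xs = M} \<le> 2) \<and>
         \<not> (\<exists>xs\<^sub>1 \<in> partitions N 6. \<exists>xs\<^sub>2 \<in> partitions N 6. \<exists>xs\<^sub>3 \<in> partitions N 6.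
               xs\<^sub>1 \<noteq> xs\<^sub>2 \<and> xs\<^sub>1 \<noteq> xs\<^sub>3 \<and> xs\<^sub>2 \<noteq> xs\<^sub>3 \<and>
               pre 3 xs\<^sub>1 = pre 3 xs\<^sub>2 \<and> pre 3 xs\<^sub>2 = pre 3 xs\<^sub>3)"
proof -
  have two: "xs = ys \<or> xs = zs \<or> ys = zs"
    if "xs \<in> partitions N 6" "ys \<in> partitions N 6" "zs \<in> partitions N 6"
      "pre 3 xs = pre 3 ys" "pre 3 ys = pre 3 zs" for xs ys zs
    using partition_eq_if_same_type[of xs N ys] partition_eq_if_same_type[of xs N zs]
      partition_eq_if_same_type[of ys N zs] that by argo
  have "card {xs \<in> partitions N 6. pre 3 xs = M} \<le> 2" for M
  proof (rule ccontr)
    assume "\<not> card {xs \<in> partitions N 6. pre 3 xs = M} \<le> 2"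
    then obtain T where "T \<subseteq> {xs \<in> partitions N 6. pre 3 xs = M}" "card T = 3"
      using obtain_subset_with_card_n[of 3] by (metis not_less_eq_eq numeral_2_eq_2 numeral_3_eq_3)
    moreover from this(2) obtain x y z where "T = {x, y, z}" "x \<noteq> y" "y \<noteq> z" "x \<noteq> z"
      unfolding card_3_iff by blast
    ultimately show False using two[of x y z] by auto
  qed
  then show ?thesis using two by blast
qed

end
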